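(* For a system $(E,A)$ the following statements are equivalent: (i) all the defects $\alpha_k$, $\beta_k^+$ and $\beta_k^-$ ($k\ge1$) of $(E,A)$ are zero; (ii) the operator $E$ is invertible.
   Context: Fix a field $\mathbb K$. A system $(E,A)$ is a pair of $\mathbb K$-linear maps $E,A:M\to V$ with the same finite-dimensional domain $M$ and the same finite-dimensional codomain $V$. Reduction: put $V'=EM$ and $M'=A^{-1}V'=\{x\in M: Ax\in V'\}$. Then $E$ and $A$ map $M'$ into $V'$; let $E',A':M'\to V'$ be the restrictions. The reduced system is $(E,A)'=(E',A')$. Define $(E^{(0)},A^{(0)})=(E,A)$ and $(E^{(k+1)},A^{(k+1)})=(E^{(k)},A^{(k)})'$, with domain $M^{(k)}$ and codomain $V^{(k)}$ of $(E^{(k)},A^{(k)})$; so $V''=V^{(2)}=EM'$. The index $n$ of $(E,A)$ is the smallest integer $n\ge 0$ with $(E^{(n+1)},A^{(n+1)})=(E^{(n)},A^{(n)})$ (it always exists), and $(E^{(\infty)},A^{(\infty)}):=(E^{(n)},A^{(n)})$. Defects: let $[A]:M/M'\to V/V'$ and $[E]:M/M'\to V'/V''$ be the maps induced by $A$ and $E$ on the quotients. Put $\beta_1^+(E,A)=\dim\operatorname{coker}[A]$, $\alpha_1(E,A)=\dim\ker[E]$, and for $k\ge1$, $\alpha_k(E,A)=\alpha_1(E^{(k-1)},A^{(k-1)})$, $\beta^+_k(E,A)=\beta^+_1(E^{(k-1)},A^{(k-1)})$. The dual system of $(E,A)$ is the pair of adjoint (transpose) maps $(E^*,A^* )$, $E^*,A^*:V^*\to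 M^*$. Write $(E^{(\infty)*},A^{(\infty)*})$ for the dual of $(E^{(\infty)},A^{(\infty)})$. For $k\ge1$, $\beta^-_k(E,A):=\beta^+_k(E^{(\infty)*},A^{(\infty)*})$. *)

theory Defs
  imports "Jordan_Normal_Form.Missing_VectorSpace" "HOL-Algebra.AbelCoset"
begin

section \<open>Quotient spaces and dual spaces\<close>

text \<open>
  Vector spaces are \<^const>\<open>vectorspace\<close> records; a subspace \<open>W\<close> is a set of vectors, and it
  becomes a space as \<open>V\<lparr>carrier := W\<rparr>\<close>.  The ring fields \<open>mult\<close> and \<open>one\<close> of a module record
  play no role and are filled in arbitrarily.
\<close>

text \<open>
  The elements of \<open>V/W\<close> are the cosets of \<open>W\<close>.  The scalar multiple of a coset adds \<open>W\<close> again, so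
  that multiplication by \<open>0\<close> gives \<open>W\<close> and not the set containing only the zero vector.
\<close>

definition quotient_space ::
    "('a, 'v, 'e) module_scheme \<Rightarrow> 'v set \<Rightarrow> ('a, 'v set) module" where
  "quotient_space V W =
    \<lparr>carrier = a_rcosets\<^bsub>V\<^esub> W,
     mult = (\<lambda>X Y. W),
     one = W,
     zero = W,
     add = set_add V,
     smult = (\<lambda>c X. \<Union>x\<in>X. W +>\<^bsub>V\<^esub> (c \<odot>\<^bsub>V\<^esub> x))\<rparr>"

text \<open>
  If \<open>T\<close> maps a subspace \<open>U\<close> into \<open>W\<close>, then \<open>T x\<close> lies in the same coset of \<open>W\<close> for all
  representatives \<open>x\<close> of a coset \<open>X\<close> of \<open>U\<close>, and the union below is that coset of \<open>W\<close>.
\<close>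

definition induced_map ::
    "('a, 'v, 'e) module_scheme \<Rightarrow> 'v set \<Rightarrow> ('m \<Rightarrow> 'v) \<Rightarrow> 'm set \<Rightarrow> 'v set" where
  "induced_map V W T X = (\<Union>x\<in>X. W +>\<^bsub>V\<^esub> T x)"

definition kernel_space ::
    "('a, 'v, 'e) module_scheme \<Rightarrow> ('a, 'w, 'f) module_scheme \<Rightarrow> ('v \<Rightarrow> 'w)
      \<Rightarrow> ('a, 'v, 'e) module_scheme" where
  "kernel_space V W T = V\<lparr>carrier := mod_hom.ker V W T\<rparr>"

definition cokernel_space ::
    "('a, 'v, 'e) module_scheme \<Rightarrow> ('a, 'w, 'f) module_scheme \<Rightarrow> ('v \<Rightarrow> 'w)
      \<Rightarrow> ('a, 'w set) module" where
  "cokernel_space V W T = quotient_space W (mod_hom.im V T)"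

definition scalar_space :: "('a, 'b) ring_scheme \<Rightarrow> ('a, 'a) module" where
  "scalar_space K =
    \<lparr>carrier = carrier K, mult = mult K, one = one K, zero = zero K, add = add K,
     smult = mult K\<rparr>"

text \<open>
  Functionals are extensional (\<^const>\<open>undefined\<close> outside the space), so that equal functionals
  are equal as HOL functions.
\<close>

definition dual_space ::
    "('a, 'b) ring_scheme \<Rightarrow> ('a, 'v, 'e) module_scheme \<Rightarrow> ('a, 'v \<Rightarrow> 'a) module" where
  "dual_space K V =
    (ring.func_space K (carrier V))
      \<lparr>carrier := module_hom K V (scalar_space K) \<inter> extensional (carrier V)\<rparr>"

definition adjoint_map :: "('a, 'm, 'e) module_scheme \<Rightarrow> ('m \<Rightarrow> 'v) \<Rightarrow> ('v \<Rightarrow> 'a) \<Rightarrow> 'm \<Rightarrow> 'a" where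
  "adjoint_map M T f = compose (carrier M) f T"

definition invertible_linear_map ::
    "('a, 'b) ring_scheme \<Rightarrow> ('a, 'v, 'e) module_scheme \<Rightarrow> ('a, 'w, 'f) module_scheme
      \<Rightarrow> ('v \<Rightarrow> 'w) \<Rightarrow> bool" where
  "invertible_linear_map K V W T \<longleftrightarrow>
    linear_map K V W T \<and>
    (\<exists>T'. linear_map K W V T' \<and>
          (\<forall>x\<in>carrier V. T' (T x) = x) \<and> (\<forall>y\<in>carrier W. T (T' y) = y))"

section \<open>Systems and their reduction\<close>

record ('a, 'm, 'v) system =
  sys_dom :: "('a, 'm) module"
  sys_cod :: "('a, 'v) module"
  sys_E :: "'m \<Rightarrow> 'v"
  sys_A :: "'m \<Rightarrow> 'v"

definition is_system :: "('a, 'b) ring_scheme \<Rightarrow> ('a, 'm, 'v) system \<Rightarrow> bool" where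
  "is_system K S \<longleftrightarrow>
    linear_map K (sys_dom S) (sys_cod S) (sys_E S) \<and>
    linear_map K (sys_dom S) (sys_cod S) (sys_A S) \<and>
    vectorspace.fin_dim K (sys_dom S) \<and>
    vectorspace.fin_dim K (sys_cod S)"

definition reduced_cod :: "('a, 'm, 'v) system \<Rightarrow> 'v set" where
  "reduced_cod S = sys_E S ` carrier (sys_dom S)"

definition reduced_dom :: "('a, 'm, 'v) system \<Rightarrow> 'm set" where
  "reduced_dom S = {x \<in> carrier (sys_dom S). sys_A S x \<in> reduced_cod S}"

text \<open>
  Only the carriers shrink; the HOL functions representing \<open>E\<close> and \<open>A\<close> are kept and are used on the
  smaller carrier only.  Hence two iterated reductions of the same system are equal as records
  iff their domains and codomains coincide, which is equality of the restricted systems.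
\<close>

definition reduce :: "('a, 'm, 'v) system \<Rightarrow> ('a, 'm, 'v) system" where
  "reduce S =
    S\<lparr>sys_dom := (sys_dom S)\<lparr>carrier := reduced_dom S\<rparr>,
      sys_cod := (sys_cod S)\<lparr>carrier := reduced_cod S\<rparr>\<rparr>"

definition iter_reduce :: "nat \<Rightarrow> ('a, 'm, 'v) system \<Rightarrow> ('a, 'm, 'v) system" where
  "iter_reduce k S = (reduce ^^ k) S"

definition sys_index :: "('a, 'm, 'v) system \<Rightarrow> nat" where
  "sys_index S = (LEAST n. iter_reduce (n + 1) S = iter_reduce n S)"

definition fully_reduced :: "('a, 'm, 'v) system \<Rightarrow> ('a, 'm, 'v) system" where
  "fully_reduced S = iter_reduce (sys_index S) S"

definition dual_system ::
    "('a, 'b) ring_scheme \<Rightarrow> ('a, 'm, 'v) system \<Rightarrow> ('a, 'v \<Rightarrow> 'a, 'm \<Rightarrow> 'a) system" where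
  "dual_system K S =
    \<lparr>sys_dom = dual_space K (sys_cod S),
     sys_cod = dual_space K (sys_dom S),
     sys_E = adjoint_map (sys_dom S) (sys_E S),
     sys_A = adjoint_map (sys_dom S) (sys_A S)\<rparr>"

section \<open>Defects\<close>

text \<open>\<open>M/M'\<close>, \<open>V/V'\<close> and \<open>V'/V''\<close>\<close>

definition dom_quotient :: "('a, 'm, 'v) system \<Rightarrow> ('a, 'm set) module" where
  "dom_quotient S = quotient_space (sys_dom S) (reduced_dom S)"

definition cod_quotient :: "('a, 'm, 'v) system \<Rightarrow> ('a, 'v set) module" where
  "cod_quotient S = quotient_space (sys_cod S) (reduced_cod S)"

definition reduced_cod_quotient :: "('a, 'm, 'v) system \<Rightarrow> ('a, 'v set) module" where
  "reduced_cod_quotient S = cod_quotient (reduce S)"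

text \<open>\<open>[A] : M/M' \<rightarrow> V/V'\<close> and \<open>[E] : M/M' \<rightarrow> V'/V''\<close>\<close>

definition bracket_A :: "('a, 'm, 'v) system \<Rightarrow> 'm set \<Rightarrow> 'v set" where
  "bracket_A S = induced_map (sys_cod S) (reduced_cod S) (sys_A S)"

definition bracket_E :: "('a, 'm, 'v) system \<Rightarrow> 'm set \<Rightarrow> 'v set" where
  "bracket_E S = induced_map (sys_cod (reduce S)) (reduced_cod (reduce S)) (sys_E S)"

definition beta_plus_1 :: "('a, 'b) ring_scheme \<Rightarrow> ('a, 'm, 'v) system \<Rightarrow> nat" where
  "beta_plus_1 K S =
    vectorspace.dim K (cokernel_space (dom_quotient S) (cod_quotient S) (bracket_A S))"

definition alpha_1 :: "('a, 'b) ring_scheme \<Rightarrow> ('a, 'm, 'v) system \<Rightarrow> nat" where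
  "alpha_1 K S =
    vectorspace.dim K (kernel_space (dom_quotient S) (reduced_cod_quotient S) (bracket_E S))"

text \<open>The defects below are meant for \<open>k \<ge> 1\<close> only.\<close>

definition alpha :: "('a, 'b) ring_scheme \<Rightarrow> nat \<Rightarrow> ('a, 'm, 'v) system \<Rightarrow> nat" where
  "alpha K k S = alpha_1 K (iter_reduce (k - 1) S)"

definition beta_plus :: "('a, 'b) ring_scheme \<Rightarrow> nat \<Rightarrow> ('a, 'm, 'v) system \<Rightarrow> nat" where
  "beta_plus K k S = beta_plus_1 K (iter_reduce (k - 1) S)"

definition beta_minus :: "('a, 'b) ring_scheme \<Rightarrow> nat \<Rightarrow> ('a, 'm, 'v) system \<Rightarrow> nat" where
  "beta_minus K k S = beta_plus K k (dual_system K (fully_reduced S))"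

end

theory Submission
  imports Defs
begin

text \<open>
  Suppose \<open>\<alpha>\<^sub>1 = 0\<close> and \<open>\<beta>\<^sub>1\<^sup>+ = 0\<close>, and suppose that \<open>E\<close> maps \<open>M'\<close> onto \<open>V'\<close>.  Then \<open>EM' = EM\<close>, so
  \<open>\<alpha>\<^sub>1 = 0\<close> gives \<open>M' = M\<close>; hence \<open>AM \<subseteq> V'\<close>, and \<open>\<beta>\<^sub>1\<^sup>+ = 0\<close> gives \<open>V' = V\<close>.  By induction on the
  dimension of the codomain, \<open>E\<close> is surjective as soon as all \<open>\<alpha>\<^sub>k\<close> and \<open>\<beta>\<^sub>k\<^sup>+\<close> vanish.  The system
  then equals its full reduction, and \<open>E\<^sup>*\<close> is injective, so that all \<open>\<alpha>\<^sub>k\<close> of the dual system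
  vanish.  Its \<open>\<beta>\<^sub>k\<^sup>+\<close> are the \<open>\<beta>\<^sub>k\<^sup>-\<close> of the original one, and the same argument shows that \<open>E\<^sup>*\<close>
  is surjective, which means that \<open>E\<close> is injective.
\<close>

section \<open>Linear maps and finite dimension\<close>

lemma linear_mapI:
  assumes "vectorspace K V" "vectorspace K W" "T \<in> module_hom K V W"
  shows "linear_map K V W T"
  using assms by (intro linear_map.intro mod_hom.intro mod_hom_axioms.intro vectorspace.axioms(1))

context linear_map
begin

text \<open>A vanishing combination of the images, with coefficients \<open>a\<close>, is the image
  of the combination with coefficients \<open>a \<circ> T\<close>. Injectivity makes the latter
  vanish, and independence of \<open>A\<close> makes its coefficients zero.\<close>

lemma lin_indpt_image:
  assumes "inj_on T (carrier V)" "finite A" "A \<subseteq> carrier V" "V.module.lin_indpt A"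
  shows "W.module.lin_indpt (T ` A)"
proof (rule W.module.finite_lin_indpt2)
  show "finite (T ` A)" "T ` A \<subseteq> carrier W" using assms by auto
next
  fix a assume a: "a \<in> T ` A \<rightarrow> carrier K" and z: "W.module.lincomb a (T ` A) = \<zero>\<^bsub>W\<^esub>"
  have "T (V.module.lincomb (a \<circ> T) A) = T \<zero>\<^bsub>V\<^esub>"
    using lincomb_linear_image[OF assms(1,3) a assms(2)] z by simp
  moreover have aT: "a \<circ> T \<in> A \<rightarrow> carrier K" using a by auto
  ultimately have "V.module.lincomb (a \<circ> T) A = \<zero>\<^bsub>V\<^esub>"
    using assms(3) by (intro inj_onD[OF assms(1)]) auto
  then show "\<forall>v\<in>T ` A. a v = \<zero>\<^bsub>K\<^esub>"
    using V.not_lindepD[OF assms(4,2) order.refl aT] by auto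
qed

text \<open>No finite basis of \<open>V\<close> is at hand, so independent sets are bounded instead:
  their images are independent in \<open>W\<close>. A maximal independent set is then finite and
  generates \<open>V\<close>.\<close>

lemma inj_fin_dim:
  assumes "inj_on T (carrier V)" "W.fin_dim"
  shows "V.fin_dim"
proof -
  let ?P = "\<lambda>A. A \<subseteq> carrier V \<and> V.module.lin_indpt A"
  have card: "card A \<le> W.dim" if "finite A" "?P A" for A
  proof -
    have "card (T ` A) = card A"
      using that assms(1) by (intro card_image) (auto intro: inj_on_subset)
    with that show ?thesis
      using W.li_le_dim(2)[OF assms(2) _ lin_indpt_image[OF assms(1)], of A] by auto
  qed
  have bnd: "finite A \<and> card A \<le> W.dim" if "?P A" for A
  proof (rule ccontr)
    assume "\<not> ?thesis"
    with card[of A] that have "infinite A" by auto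
    \<comment> \<open>One element more than the bound, found inside the infinite independent set
      \<open>A\<close>.\<close>
    then obtain B where B: "B \<subseteq> A" "finite B" "card B = Suc W.dim"
      using infinite_arbitrarily_large by blast
    have "?P B" using B(1) that V.module.subset_li_is_li by blast
    from card[OF B(2) this] B(3) show False by simp
  qed
  have "?P {}" by (auto simp: V.module.lin_dep_def)
  then obtain A where A: "finite A" "maximal A ?P"
    using maximal_exists[of ?P, OF bnd] by blast
  then have "V.module.gen_set A" using V.max_li_is_gen by blast
  with A show ?thesis unfolding V.fin_dim_def maximal_def by blast
qed

lemma linear_map_the_inv_into:
  assumes "bij_betw T (carrier V) (carrier W)"
  shows "linear_map K W V (the_inv_into (carrier V) T)"
proof -
  let ?S = "the_inv_into (carrier V) T"
  have inj: "inj_on T (carrier V)" using assms by (simp add: bij_betw_def)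
  have S: "?S y \<in> carrier V" "T (?S y) = y" if "y \<in> carrier W" for y
    using assms that the_inv_into_into[OF inj _ order.refl] f_the_inv_into_f[OF inj]
    by (auto simp: bij_betw_def)
  have eq: "?S y = x" if "x \<in> carrier V" "y = T x" for x y
    using the_inv_into_f_f[OF inj that(1)] that(2) by simp
  have "?S \<in> module_hom K W V"
    unfolding module_hom_def by (auto simp: S intro!: eq)
  then show ?thesis
    by (intro linear_mapI V.vectorspace_axioms W.vectorspace_axioms)
qed

text \<open>A bijective linear map has a linear inverse, \<open>the_inv_into\<close>; so only
  injectivity and surjectivity of \<open>E\<close> have to be studied.\<close>

lemma invertible_linear_map_iff:
  "invertible_linear_map K V W T \<longleftrightarrow> bij_betw T (carrier V) (carrier W)"
proof
  assume "invertible_linear_map K V W T"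
  then obtain T' where "linear_map K W V T'"
    and T': "\<forall>x\<in>carrier V. T' (T x) = x" "\<forall>y\<in>carrier W. T (T' y) = y"
    unfolding invertible_linear_map_def by blast
  then interpret T': linear_map K W V T' by simp
  show "bij_betw T (carrier V) (carrier W)"
    by (rule bij_betw_byWitness[where f' = T']) (use T' in auto)
next
  assume b: "bij_betw T (carrier V) (carrier W)"
  then have inj: "inj_on T (carrier V)" by (simp add: bij_betw_def)
  show "invertible_linear_map K V W T"
    unfolding invertible_linear_map_def
    using linear_map_the_inv_into[OF b] the_inv_into_f_f[OF inj] f_the_inv_into_f[OF inj] b
      linear_map_axioms by (auto simp: bij_betw_def)
qed

end

section \<open>Subspaces, dimension zero and strict monotonicity of the dimension\<close>

context vectorspace
begin

lemma inclusion_linear_map: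
  assumes "subspace K W V"
  shows "linear_map K (vs W) V (\<lambda>x. x)"
proof -
  interpret W: vectorspace K "vs W" by (rule subspace_is_vs[OF assms])
  have "W \<subseteq> carrier V" using assms by (simp add: subspace_def submodule_def)
  then have "(\<lambda>x. x) \<in> module_hom K (vs W) V" by (auto simp: module_hom_def)
  then show ?thesis
    by (intro linear_mapI vectorspace_axioms W.vectorspace_axioms)
qed

lemma fin_dim_subspace:
  assumes "fin_dim" "subspace K W V"
  shows "vectorspace.fin_dim K (vs W)"
  using linear_map.inj_fin_dim[OF inclusion_linear_map[OF assms(2)] _ assms(1)] by simp

text \<open>All defects are dimensions; this turns their vanishing into a statement about
  vectors.\<close>

lemma dim_eq_0_iff:
  assumes "fin_dim"
  shows "dim = 0 \<longleftrightarrow> carrier V = {\<zero>\<^bsub>V\<^esub>}"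
proof
  assume "dim = 0"
  moreover obtain B where "finite B" "basis B" using finite_basis_exists[OF assms] by blast
  ultimately show "carrier V = {\<zero>\<^bsub>V\<^esub>}"
    using dim_basis span_empty by (auto simp: basis_def)
next
  assume "carrier V = {\<zero>\<^bsub>V\<^esub>}"
  then have "basis {}" using span_empty by (auto simp: basis_def lin_dep_def)
  then show "dim = 0" using dim_basis by force
qed

text \<open>A basis of \<open>W\<close> with at least \<open>dim\<close> elements would already be a
  basis of \<open>V\<close>. The strict decrease drives the later induction on the codomain.\<close>

lemma dim_subspace_less:
  assumes "fin_dim" "subspace K W V" "W \<noteq> carrier V"
  shows "vectorspace.dim K (vs W) < dim"
proof -
  interpret W: vectorspace K "vs W" by (rule subspace_is_vs[OF assms(2)])
  have sub: "submodule K W V" using assms(2) by (rule is_module)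
  then have WV: "W \<subseteq> carrier V" by (simp add: submodule_def)
  obtain B where B: "finite B" "W.basis B"
    using W.finite_basis_exists[OF fin_dim_subspace[OF assms(1,2)]] by blast
  then have BW: "B \<subseteq> W" by (simp add: W.basis_def)
  have li: "lin_indpt B" and span: "span B = W"
    using B(2) span_li_not_depend[OF BW sub] by (auto simp: W.basis_def)
  have "\<not> dim \<le> card B"
  proof
    assume "dim \<le> card B"
    then have "basis B" using dim_li_is_basis[OF assms(1) B(1) _ li] BW WV by auto
    then show False using span assms(3) by (simp add: basis_def)
  qed
  then show ?thesis using W.dim_basis[OF B] by simp
qed

end

section \<open>Quotient spaces and induced maps\<close>

context subspace
begin

sublocale vectorspace K V by (rule vs)

lemma subset: "W \<subseteq> carrier V"
  using submod by (simp add: submodule_def)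

lemma zero_mem: "\<zero> \<in> W"
  using submod by (simp add: submodule_def)

lemma add_mem: "x \<in> W \<Longrightarrow> y \<in> W \<Longrightarrow> x \<oplus> y \<in> W"
  using submod by (simp add: submodule_def)

lemma smult_mem: "c \<in> carrier K \<Longrightarrow> x \<in> W \<Longrightarrow> c \<odot> x \<in> W"
  using submod by (simp add: submodule_def)

lemma neg_mem: "x \<in> W \<Longrightarrow> \<ominus> x \<in> W"
  using smult_mem[of "\<ominus>\<^bsub>K\<^esub> \<one>\<^bsub>K\<^esub>" x] smult_minus_1[of x] subset by auto

text \<open>Opens the coset theory of abelian groups to subspaces.\<close>

lemma abelian_subgroup: "abelian_subgroup W V"
proof (rule abelian_subgroupI3)
  show "abelian_group V" by unfold_locales
  show "additive_subgroup W V"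
    by (intro additive_subgroup.intro add.subgroupI)
      (use subset zero_mem add_mem neg_mem in \<open>auto simp: a_inv_def\<close>)
qed

sublocale cosets: abelian_subgroup W V
  by (rule abelian_subgroup)

lemma minus_add_cancel: "x \<in> carrier V \<Longrightarrow> y \<in> carrier V \<Longrightarrow> (x \<ominus> y) \<oplus> y = x"
  by (simp add: a_minus_def a_assoc l_neg)

lemma mem_coset_iff:
  assumes "x \<in> carrier V" "y \<in> carrier V"
  shows "y \<in> W +> x \<longleftrightarrow> y \<ominus> x \<in> W"
proof
  assume "y \<in> W +> x"
  then obtain w where "w \<in> W" "y = w \<oplus> x" by (auto simp: a_r_coset_def')
  with assms(1) subset show "y \<ominus> x \<in> W" by (auto simp: a_minus_def a_assoc r_neg)
next
  assume "y \<ominus> x \<in> W"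
  then show "y \<in> W +> x"
    using minus_add_cancel[OF assms(2,1)] by (force simp: a_r_coset_def')
qed

lemma coset_eq_iff:
  assumes "x \<in> carrier V" "y \<in> carrier V"
  shows "W +> x = W +> y \<longleftrightarrow> x \<ominus> y \<in> W"
  using mem_coset_iff[OF assms(2,1)] assms
  by (metis cosets.a_repr_independence' cosets.a_repr_independenceD)

lemma coset_eq_self_iff:
  assumes "x \<in> carrier V"
  shows "W +> x = W \<longleftrightarrow> x \<in> W"
proof -
  have "x \<ominus> \<zero> = x"
    using minus_add_cancel[OF assms zero_closed] assms by simp
  then show ?thesis
    using coset_eq_iff[OF assms zero_closed] a_coset_add_zero[OF subset] by simp
qed

text \<open>The common well-definedness argument: scalar multiples of cosets and
  \<open>induced_map\<close> are unions over all representatives, and such a union collapses once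
  its members agree, since \<open>x\<close> lies in its own coset.\<close>

lemma union_cosets_image:
  assumes "x \<in> carrier V" "\<And>y. y \<in> W +> x \<Longrightarrow> F y = F x"
  shows "(\<Union>y\<in>W +> x. F y) = F x"
  using cosets.a_rcos_self[OF assms(1)] assms(2) by blast

lemma carrier_quotient_space: "carrier (quotient_space V W) = (\<lambda>x. W +> x) ` carrier V"
  by (auto simp: quotient_space_def A_RCOSETS_def')

lemma zero_quotient_space: "\<zero>\<^bsub>quotient_space V W\<^esub> = W"
  by (simp add: quotient_space_def)

lemma add_quotient_space:
  assumes "x \<in> carrier V" "y \<in> carrier V"
  shows "(W +> x) \<oplus>\<^bsub>quotient_space V W\<^esub> (W +> y) = W +> (x \<oplus> y)"
  using cosets.a_rcos_sum[OF assms] by (simp add: quotient_space_def)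

lemma smult_minus_distr:
  assumes "c \<in> carrier K" "x \<in> carrier V" "y \<in> carrier V"
  shows "c \<odot> (x \<ominus> y) = c \<odot> x \<ominus> c \<odot> y"
  using assms smult_minus_1
  by (simp add: a_minus_def smult_r_distr smult_r_minus)

lemma smult_quotient_space:
  assumes "c \<in> carrier K" "x \<in> carrier V"
  shows "c \<odot>\<^bsub>quotient_space V W\<^esub> (W +> x) = W +> (c \<odot> x)"
proof -
  have "W +> (c \<odot> y) = W +> (c \<odot> x)" if "y \<in> W +> x" for y
  proof -
    have y: "y \<in> carrier V"
      using that assms(2) subset by (auto simp: a_r_coset_def')
    then have "c \<odot> (y \<ominus> x) \<in> W"
      using that assms by (simp add: mem_coset_iff smult_mem)
    then show ?thesis
      using y assms by (simp add: coset_eq_iff smult_minus_distr)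
  qed
  then show ?thesis
    using union_cosets_image[OF assms(2), of "\<lambda>y. W +> (c \<odot> y)"]
    by (simp add: quotient_space_def)
qed

lemmas quotient_space_simps =
  carrier_quotient_space zero_quotient_space add_quotient_space smult_quotient_space

lemma vectorspace_quotient_space: "vectorspace K (quotient_space V W)"
proof -
  \<comment> \<open>The zero of the quotient is stored as \<open>W\<close>; written as the coset of
    the zero vector, it falls under the coset rules.\<close>
  have zero: "W = W +> \<zero>"
    using coset_eq_self_iff[OF zero_closed] zero_mem by simp
  have neg: "\<exists>X\<in>carrier (quotient_space V W). (W +> x) \<oplus>\<^bsub>quotient_space V W\<^esub> X = W"
    if "x \<in> carrier V" for x
    using that zero by (intro bexI[of _ "W +> (\<ominus> x)"]) (auto simp: quotient_space_simps r_neg)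
  show ?thesis
  proof (rule vs_criteria)
    show "field K" by unfold_locales
    show "\<zero>\<^bsub>quotient_space V W\<^esub> \<in> carrier (quotient_space V W)"
      using zero by (auto simp: quotient_space_simps)
    show "\<forall>v\<in>carrier (quotient_space V W).
       v \<oplus>\<^bsub>quotient_space V W\<^esub> \<zero>\<^bsub>quotient_space V W\<^esub> = v"
    proof
      fix v assume "v \<in> carrier (quotient_space V W)"
      then obtain x where "x \<in> carrier V" "v = W +> x" by (auto simp: carrier_quotient_space)
      then show "v \<oplus>\<^bsub>quotient_space V W\<^esub> \<zero>\<^bsub>quotient_space V W\<^esub> = v"
        using add_quotient_space[of x \<zero>] zero by (simp add: zero_quotient_space)
    qed
    show "\<forall>v\<in>carrier (quotient_space V W). \<exists>neg_v\<in>carrier (quotient_space V W).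
       v \<oplus>\<^bsub>quotient_space V W\<^esub> neg_v = \<zero>\<^bsub>quotient_space V W\<^esub>"
      using neg by (auto simp: carrier_quotient_space[of] zero_quotient_space)
  qed (auto simp: quotient_space_simps a_ac smult_assoc1 smult_l_distr smult_r_distr)
qed

lemma linear_map_coset: "linear_map K V (quotient_space V W) (\<lambda>x. W +> x)"
proof -
  interpret Q: vectorspace K "quotient_space V W" by (rule vectorspace_quotient_space)
  have "(\<lambda>x. W +> x) \<in> module_hom K V (quotient_space V W)"
    by (auto simp: module_hom_def quotient_space_simps)
  then show ?thesis
    by (intro linear_mapI vectorspace_axioms Q.vectorspace_axioms)
qed

lemma fin_dim_quotient_space:
  assumes "fin_dim"
  shows "vectorspace.fin_dim K (quotient_space V W)"
  using linear_map.surj_fin_dim[OF linear_map_coset assms] by (simp add: carrier_quotient_space)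

lemma quotient_space_trivial_iff:
  "carrier (quotient_space V W) = {\<zero>\<^bsub>quotient_space V W\<^esub>} \<longleftrightarrow> W = carrier V"
proof -
  have "(\<lambda>x. W +> x) ` carrier V = {W} \<longleftrightarrow> (\<forall>x\<in>carrier V. W +> x = W)"
    using zero_closed by blast
  then show ?thesis
    using subset coset_eq_self_iff by (auto simp: carrier_quotient_space zero_quotient_space)
qed

lemma dim_quotient_space_eq_0_iff:
  assumes "fin_dim"
  shows "vectorspace.dim K (quotient_space V W) = 0 \<longleftrightarrow> W = carrier V"
  using vectorspace.dim_eq_0_iff[OF vectorspace_quotient_space fin_dim_quotient_space[OF assms]]
    quotient_space_trivial_iff by simp

end

text \<open>Two representatives of a coset of \<open>U\<close> differ by an element of
  \<open>U\<close>, so their images differ by an element of \<open>X\<close>. Hence any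
  representative computes the induced map, and linearity is inherited from \<open>T\<close>.\<close>

lemma (in linear_map)
  assumes U: "subspace K U V" and X: "subspace K X W" and UX: "T ` U \<subseteq> X"
  shows induced_map_coset:
      "x \<in> carrier V \<Longrightarrow> induced_map W X T (U +>\<^bsub>V\<^esub> x) = X +>\<^bsub>W\<^esub> T x"
    and linear_map_induced_map:
      "linear_map K (quotient_space V U) (quotient_space W X) (induced_map W X T)"
proof -
  interpret U: subspace K U V by (rule U)
  interpret X: subspace K X W by (rule X)
  show ind: "induced_map W X T (U +>\<^bsub>V\<^esub> x) = X +>\<^bsub>W\<^esub> T x" if x: "x \<in> carrier V" for x
    unfolding induced_map_def
  proof (rule U.union_cosets_image[OF x])
    fix y assume y: "y \<in> U +>\<^bsub>V\<^esub> x"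
    then have yV: "y \<in> carrier V"
      using x U.subset by (auto simp: a_r_coset_def')
    then have "y \<ominus>\<^bsub>V\<^esub> x \<in> U" using y x by (simp add: U.mem_coset_iff)
    then have "T (y \<ominus>\<^bsub>V\<^esub> x) \<in> X" using UX by blast
    then show "X +>\<^bsub>W\<^esub> T y = X +>\<^bsub>W\<^esub> T x" using x yV by (simp add: X.coset_eq_iff)
  qed
  interpret QV: vectorspace K "quotient_space V U" by (rule U.vectorspace_quotient_space)
  interpret QW: vectorspace K "quotient_space W X" by (rule X.vectorspace_quotient_space)
  have "induced_map W X T \<in> module_hom K (quotient_space V U) (quotient_space W X)"
    unfolding module_hom_def
    by (auto simp: U.quotient_space_simps X.quotient_space_simps ind)
  then show "linear_map K (quotient_space V U) (quotient_space W X) (induced_map W X T)"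
    by (intro linear_mapI QV.vectorspace_axioms QW.vectorspace_axioms)
qed

section \<open>Dual spaces\<close>

context vectorspace
begin

lemma mem_dual_space_iff:
  "f \<in> carrier (dual_space K V) \<longleftrightarrow>
    f \<in> carrier V \<rightarrow>\<^sub>E carrier K \<and>
    (\<forall>x\<in>carrier V. \<forall>y\<in>carrier V. f (x \<oplus>\<^bsub>V\<^esub> y) = f x \<oplus>\<^bsub>K\<^esub> f y) \<and>
    (\<forall>c\<in>carrier K. \<forall>x\<in>carrier V. f (c \<odot>\<^bsub>V\<^esub> x) = c \<otimes>\<^bsub>K\<^esub> f x)"
  unfolding dual_space_def module_hom_def scalar_space_def PiE_def by auto

lemma dual_space_simps:
  "\<zero>\<^bsub>dual_space K V\<^esub> = (\<lambda>x\<in>carrier V. \<zero>\<^bsub>K\<^esub>)"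
  "f \<oplus>\<^bsub>dual_space K V\<^esub> g = (\<lambda>x\<in>carrier V. f x \<oplus>\<^bsub>K\<^esub> g x)"
  "c \<odot>\<^bsub>dual_space K V\<^esub> f = (\<lambda>x\<in>carrier V. c \<otimes>\<^bsub>K\<^esub> f x)"
  unfolding dual_space_def func_space_def by simp_all

text \<open>The functionals form a subspace of the space of all extensional functions into
  \<open>K\<close>, so the axioms are inherited.\<close>

lemma vectorspace_dual_space: "vectorspace K (dual_space K V)"
proof -
  interpret F: vectorspace K "func_space (carrier V)" by (rule func_space_is_vs)
  have "carrier (dual_space K V) \<subseteq> carrier V \<rightarrow>\<^sub>E carrier K"
    using mem_dual_space_iff by blast
  then have "submodule K (carrier (dual_space K V)) (func_space (carrier V))"
    by (intro submodule.intro F.module_axioms)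
      (auto simp: mem_dual_space_iff func_space_def PiE_iff R.a_ac R.m_ac R.r_distr)
  then have "subspace K (carrier (dual_space K V)) (func_space (carrier V))"
    by (intro subspace.intro F.vectorspace_axioms)
  from F.subspace_is_vs[OF this] show ?thesis
    by (simp add: dual_space_def)
qed

lemma dual_space_apply_zero:
  assumes "f \<in> carrier (dual_space K V)"
  shows "f \<zero>\<^bsub>V\<^esub> = \<zero>\<^bsub>K\<^esub>"
proof -
  have "\<forall>c\<in>carrier K. \<forall>x\<in>carrier V. f (c \<odot>\<^bsub>V\<^esub> x) = c \<otimes>\<^bsub>K\<^esub> f x"
    and "f \<zero>\<^bsub>V\<^esub> \<in> carrier K"
    using assms by (auto simp: mem_dual_space_iff)
  from this(1)[rule_format, of "\<zero>\<^bsub>K\<^esub>" "\<zero>\<^bsub>V\<^esub>"] this(2) show ?thesis by simp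
qed

text \<open>The vectors on which two functionals agree form a submodule, so agreement spreads from
  generators to the whole space.\<close>

lemma dual_space_eqI:
  assumes "f \<in> carrier (dual_space K V)" "g \<in> carrier (dual_space K V)"
    and "B \<subseteq> carrier V" "gen_set B" "\<And>x. x \<in> B \<Longrightarrow> f x = g x"
  shows "f = g"
proof -
  have "submodule K {x \<in> carrier V. f x = g x} V"
    using assms(1,2) dual_space_apply_zero[OF assms(1)] dual_space_apply_zero[OF assms(2)]
    by (intro submodule.intro module_axioms) (auto simp: mem_dual_space_iff)
  then have "span B \<subseteq> {x \<in> carrier V. f x = g x}"
    using assms(3,5) by (intro span_is_subset) auto
  then have "f x = g x" if "x \<in> carrier V" for x
    using assms(4) that by auto
  then show ?thesis
    using assms(1,2) by (auto simp: mem_dual_space_iff intro: PiE_ext)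
qed

text \<open>Existence and uniqueness of coordinates. Coefficient families are extensional on
  \<open>B\<close>, so that equal families are equal HOL functions.\<close>

lemma bij_betw_lincomb_basis:
  assumes "finite B" "basis B"
  shows "bij_betw (\<lambda>a. lincomb a B) (carrier (func_space B)) (carrier V)"
proof -
  have B: "B \<subseteq> carrier V" using assms(2) by (simp add: basis_def)
  have "\<exists>!a. a \<in> B \<rightarrow>\<^sub>E carrier K \<and> lincomb a B = v" if "v \<in> carrier V" for v
    using basis_criterion[OF assms(1) B] assms(2) that by blast
  moreover have "lincomb a B \<in> carrier V" if "a \<in> B \<rightarrow>\<^sub>E carrier K" for a
    using that B by auto
  ultimately show ?thesis
    unfolding bij_betw_def inj_on_def image_def func_space_def by auto metis+
qed

text \<open>Evaluation at a basis embeds the dual space linearly into the space itself.\<close>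

lemma fin_dim_dual_space:
  assumes "fin_dim"
  shows "vectorspace.fin_dim K (dual_space K V)"
proof -
  interpret D: vectorspace K "dual_space K V" by (rule vectorspace_dual_space)
  obtain B where B: "finite B" "basis B" using finite_basis_exists[OF assms] by blast
  then have BV: "B \<subseteq> carrier V" and gen: "gen_set B" by (auto simp: basis_def)
  let ?T = "\<lambda>f. lincomb f B"
  have BK: "f \<in> B \<rightarrow> carrier K" if "f \<in> carrier (dual_space K V)" for f
    using that BV by (auto simp: mem_dual_space_iff)
  have T_add: "?T (f \<oplus>\<^bsub>dual_space K V\<^esub> g) = ?T f \<oplus>\<^bsub>V\<^esub> ?T g"
    if "f \<in> carrier (dual_space K V)" "g \<in> carrier (dual_space K V)" for f g
  proof -
    have "?T (f \<oplus>\<^bsub>dual_space K V\<^esub> g) = ?T (\<lambda>x. f x \<oplus>\<^bsub>K\<^esub> g x)"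
      using BV BK[OF that(1)] BK[OF that(2)] by (intro lincomb_cong) (auto simp: dual_space_simps)
    then show ?thesis using lincomb_sum[OF B(1) BV] BK that by simp
  qed
  have T_smult: "?T (c \<odot>\<^bsub>dual_space K V\<^esub> f) = c \<odot>\<^bsub>V\<^esub> ?T f"
    if "f \<in> carrier (dual_space K V)" "c \<in> carrier K" for f c
  proof -
    have "?T (c \<odot>\<^bsub>dual_space K V\<^esub> f) = ?T (\<lambda>x. c \<otimes>\<^bsub>K\<^esub> f x)"
      using BV BK[OF that(1)] that(2) by (intro lincomb_cong) (auto simp: dual_space_simps)
    then show ?thesis using lincomb_smult[OF BV] BK that by simp
  qed
  have "?T \<in> module_hom K (dual_space K V) V"
    unfolding module_hom_def using T_add T_smult BV BK by auto
  then interpret T: linear_map K "dual_space K V" V ?T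
    by (intro linear_mapI D.vectorspace_axioms vectorspace_axioms)
  have "inj_on ?T (carrier (dual_space K V))"
  proof (rule inj_onI)
    fix f g
    assume f: "f \<in> carrier (dual_space K V)" and g: "g \<in> carrier (dual_space K V)"
      and eq: "lincomb f B = lincomb g B"
    \<comment> \<open>\<open>lincomb\<close> reads coefficients only on \<open>B\<close>, but the
      coordinate bijection is stated for families extensional on \<open>B\<close>; hence the
      restriction.\<close>
    have "lincomb (restrict f B) B = lincomb (restrict g B) B"
      using eq lincomb_restrict[OF BV BK[OF f], of "restrict f B"]
        lincomb_restrict[OF BV BK[OF g], of "restrict g B"] by simp
    then have "restrict f B = restrict g B"
      using bij_betw_imp_inj_on[OF bij_betw_lincomb_basis[OF B]] BK[OF f] BK[OF g]
      by (auto simp: func_space_def dest!: inj_onD)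
    then have "f x = g x" if "x \<in> B" for x
      using that by (metis restrict_apply')
    with f g BV gen show "f = g" by (rule dual_space_eqI)
  qed
  then show ?thesis using T.inj_fin_dim assms by blast
qed

text \<open>The coordinates of \<open>x\<close> in a finite basis are values of functionals at
  \<open>x\<close>, so all of them vanish.\<close>

lemma dual_space_separates:
  assumes "fin_dim" "x \<in> carrier V" and x: "\<And>f. f \<in> carrier (dual_space K V) \<Longrightarrow> f x = \<zero>\<^bsub>K\<^esub>"
  shows "x = \<zero>\<^bsub>V\<^esub>"
proof -
  obtain B where B: "finite B" "basis B" using finite_basis_exists[OF assms(1)] by blast
  then have BV: "B \<subseteq> carrier V" by (simp add: basis_def)
  note bij = bij_betw_lincomb_basis[OF B]
  \<comment> \<open>\<open>c\<close> sends a vector to its coordinates in \<open>B\<close>; as the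
    inverse of a linear bijection it is linear.\<close>
  define c where "c = the_inv_into (carrier (func_space B)) (\<lambda>a. lincomb a B)"
  interpret F: vectorspace K "func_space B" by (rule func_space_is_vs)
  interpret c: linear_map K V "func_space B" c
    unfolding c_def using linear_map.linear_map_the_inv_into[OF lincomb_is_linear[OF B(1) BV] bij] .
  have c: "c y \<in> B \<rightarrow>\<^sub>E carrier K" if "y \<in> carrier V" for y
    using c.f_im[OF that] by (simp add: func_space_def)
  have c_add: "c (y \<oplus>\<^bsub>V\<^esub> z) b = c y b \<oplus>\<^bsub>K\<^esub> c z b"
    if "y \<in> carrier V" "z \<in> carrier V" "b \<in> B" for y z b
    using c.f_add[OF that(1,2)] that(3) by (simp add: func_space_def)
  have c_smult: "c (r \<odot>\<^bsub>V\<^esub> y) b = r \<otimes>\<^bsub>K\<^esub> c y b"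
    if "r \<in> carrier K" "y \<in> carrier V" "b \<in> B" for r y b
    using c.f_smult[OF that(1,2)] that(3) by (simp add: func_space_def)
  have "c x b = \<zero>\<^bsub>K\<^esub>" if b: "b \<in> B" for b
  proof -
    have "(\<lambda>y\<in>carrier V. c y b) \<in> carrier (dual_space K V)"
      using c b c_add c_smult by (auto simp: mem_dual_space_iff PiE_iff)
    from x[OF this] show ?thesis using assms(2) by simp
  qed
  then have "lincomb (c x) B = \<zero>\<^bsub>V\<^esub>" using lincomb_zero[OF BV] by auto
  then show ?thesis
    using f_the_inv_into_f_bij_betw[OF bij, of x] assms(2) by (simp add: c_def)
qed

end

section \<open>Adjoint maps between dual spaces\<close>

lemma (in linear_map) linear_map_adjoint:
  "linear_map K (dual_space K W) (dual_space K V) (adjoint_map V T)"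
proof -
  interpret DV: vectorspace K "dual_space K V" by (rule V.vectorspace_dual_space)
  interpret DW: vectorspace K "dual_space K W" by (rule W.vectorspace_dual_space)
  have "adjoint_map V T \<in> module_hom K (dual_space K W) (dual_space K V)"
    unfolding module_hom_def
    by (auto simp: V.mem_dual_space_iff W.mem_dual_space_iff V.dual_space_simps
        W.dual_space_simps adjoint_map_def compose_def PiE_iff
        intro!: restrict_ext)
  then show ?thesis
    by (intro linear_mapI DV.vectorspace_axioms DW.vectorspace_axioms)
qed

section \<open>Systems, their reductions and defects\<close>

locale linear_system =
  fixes K :: "('a, 'b) ring_scheme" and S :: "('a, 'm, 'v) system"
  assumes is_system: "is_system K S"
begin

abbreviation "M \<equiv> sys_dom S"
abbreviation "V \<equiv> sys_cod S"
abbreviation "E \<equiv> sys_E S"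
abbreviation "A \<equiv> sys_A S"

sublocale E: linear_map K M V E
  using is_system by (simp add: is_system_def)

sublocale A: linear_map K M V A
  using is_system by (simp add: is_system_def)

lemma fin_dims: "E.V.fin_dim" "E.W.fin_dim"
  using is_system by (auto simp: is_system_def)

lemma reduced_dom_subset: "reduced_dom S \<subseteq> carrier M"
  by (auto simp: reduced_dom_def)

lemma subspace_reduced_cod: "subspace K (reduced_cod S) V"
  using E.imT_is_subspace by (simp add: E.im_def reduced_cod_def)

lemma subspace_reduced_dom: "subspace K (reduced_dom S) M"
proof -
  interpret V': subspace K "reduced_cod S" V by (rule subspace_reduced_cod)
  have "submodule K (reduced_dom S) M"
    by (intro submodule.intro vectorspace.axioms(1)[OF E.V.vectorspace_axioms])
      (auto simp: reduced_dom_def V'.zero_mem V'.add_mem V'.smult_mem)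
  then show ?thesis by (intro subspace.intro E.V.vectorspace_axioms)
qed

lemma linear_system_reduce: "linear_system K (reduce S)"
proof -
  interpret V': vectorspace K "V\<lparr>carrier := reduced_cod S\<rparr>"
    by (rule E.W.subspace_is_vs[OF subspace_reduced_cod])
  interpret M': vectorspace K "M\<lparr>carrier := reduced_dom S\<rparr>"
    by (rule E.V.subspace_is_vs[OF subspace_reduced_dom])
  have "E \<in> module_hom K (M\<lparr>carrier := reduced_dom S\<rparr>) (V\<lparr>carrier := reduced_cod S\<rparr>)"
    and "A \<in> module_hom K (M\<lparr>carrier := reduced_dom S\<rparr>) (V\<lparr>carrier := reduced_cod S\<rparr>)"
    unfolding module_hom_def by (auto simp: reduced_dom_def reduced_cod_def)
  note maps = this[THEN linear_mapI[OF M'.vectorspace_axioms V'.vectorspace_axioms]]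
  show ?thesis
    using maps E.V.fin_dim_subspace[OF fin_dims(1) subspace_reduced_dom]
      E.W.fin_dim_subspace[OF fin_dims(2) subspace_reduced_cod]
    by (intro linear_system.intro) (simp add: is_system_def reduce_def)
qed

lemma reduced_cod_reduce: "reduced_cod (reduce S) = E ` reduced_dom S"
  by (simp add: reduced_cod_def reduce_def)

text \<open>The class of \<open>x\<close> lies in the kernel of \<open>[E]\<close> iff
  \<open>E x\<close> lies in \<open>V'' = E M'\<close>, and it is zero iff \<open>x\<close> lies in
  \<open>M'\<close>.\<close>

lemma alpha_1_eq_0_iff:
  "alpha_1 K S = 0 \<longleftrightarrow> (\<forall>x\<in>carrier M. E x \<in> E ` reduced_dom S \<longrightarrow> x \<in> reduced_dom S)"
proof -
  let ?Q = "dom_quotient S" and ?R = "reduced_cod_quotient S" and ?T = "bracket_E S"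
  interpret R: linear_system K "reduce S" by (rule linear_system_reduce)
  interpret M': subspace K "reduced_dom S" M by (rule subspace_reduced_dom)
  interpret V'': subspace K "reduced_cod (reduce S)" "sys_cod (reduce S)"
    by (rule R.subspace_reduced_cod)
  have V': "carrier (sys_cod (reduce S)) = E ` carrier M"
    by (simp add: reduce_def reduced_cod_def)
  \<comment> \<open>\<open>[E]\<close> takes values in \<open>V'/V''\<close>, so \<open>E\<close> is
    first corestricted to its image \<open>V'\<close>, while its domain stays all of
    \<open>M\<close>.\<close>
  have "E \<in> module_hom K M (sys_cod (reduce S))"
    unfolding module_hom_def V' by (auto simp: reduce_def)
  then interpret EV': linear_map K M "sys_cod (reduce S)" E
    by (intro linear_mapI E.V.vectorspace_axioms R.E.W.vectorspace_axioms)
  have sub: "E ` reduced_dom S \<subseteq> reduced_cod (reduce S)"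
    by (simp add: reduced_cod_reduce)
  note bracket = EV'.induced_map_coset[OF M'.subspace_axioms V''.subspace_axioms sub, folded bracket_E_def]
  interpret T: linear_map K ?Q ?R ?T
    unfolding dom_quotient_def reduced_cod_quotient_def cod_quotient_def bracket_E_def
    by (rule EV'.linear_map_induced_map[OF M'.subspace_axioms V''.subspace_axioms sub])
  interpret ker: vectorspace K "kernel_space ?Q ?R ?T"
    unfolding kernel_space_def by (rule T.V.subspace_is_vs[OF T.kerT_is_subspace])
  have Q: "carrier ?Q = (\<lambda>x. reduced_dom S +>\<^bsub>M\<^esub> x) ` carrier M" "\<zero>\<^bsub>?Q\<^esub> = reduced_dom S"
    by (simp_all add: dom_quotient_def M'.quotient_space_simps)
  have R0: "\<zero>\<^bsub>?R\<^esub> = reduced_cod (reduce S)"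
    by (simp add: reduced_cod_quotient_def cod_quotient_def V''.quotient_space_simps)
  have fin: "ker.fin_dim"
    unfolding kernel_space_def
    using T.V.fin_dim_subspace[OF _ T.kerT_is_subspace] M'.fin_dim_quotient_space[OF fin_dims(1)]
    by (simp add: dom_quotient_def)
  have "alpha_1 K S = 0 \<longleftrightarrow> carrier (kernel_space ?Q ?R ?T) = {\<zero>\<^bsub>kernel_space ?Q ?R ?T\<^esub>}"
    using ker.dim_eq_0_iff[OF fin] by (simp add: alpha_1_def)
  also have "\<dots> \<longleftrightarrow> (\<forall>X\<in>carrier ?Q. ?T X = \<zero>\<^bsub>?R\<^esub> \<longrightarrow> X = \<zero>\<^bsub>?Q\<^esub>)"
    by (auto simp: kernel_space_def T.ker_def)
  also have "\<dots> \<longleftrightarrow> (\<forall>x\<in>carrier M. E x \<in> E ` reduced_dom S \<longrightarrow> x \<in> reduced_dom S)"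
    using V''.coset_eq_self_iff M'.coset_eq_self_iff
    by (simp add: Q R0 bracket V' reduced_cod_reduce)
  finally show ?thesis .
qed

text \<open>The image of \<open>[A]\<close> consists of the cosets \<open>A x + V'\<close>, so a
  zero cokernel means \<open>V = V' + A M\<close>.\<close>

lemma beta_plus_1_eq_0_iff:
  "beta_plus_1 K S = 0 \<longleftrightarrow> (\<forall>v\<in>carrier V. \<exists>x\<in>carrier M. v \<ominus>\<^bsub>V\<^esub> A x \<in> reduced_cod S)"
proof -
  let ?Q = "dom_quotient S" and ?R = "cod_quotient S" and ?T = "bracket_A S"
  interpret M': subspace K "reduced_dom S" M by (rule subspace_reduced_dom)
  interpret V': subspace K "reduced_cod S" V by (rule subspace_reduced_cod)
  have sub: "A ` reduced_dom S \<subseteq> reduced_cod S"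
    unfolding reduced_dom_def by blast
  note bracket = A.induced_map_coset[OF M'.subspace_axioms V'.subspace_axioms sub, folded bracket_A_def]
  interpret T: linear_map K ?Q ?R ?T
    unfolding dom_quotient_def cod_quotient_def bracket_A_def
    by (rule A.linear_map_induced_map[OF M'.subspace_axioms V'.subspace_axioms sub])
  interpret im: subspace K T.imT ?R by (rule T.imT_is_subspace)
  have fin: "T.W.fin_dim"
    using V'.fin_dim_quotient_space[OF fin_dims(2)] by (simp add: cod_quotient_def)
  have carrier_Q: "carrier ?Q = (\<lambda>x. reduced_dom S +>\<^bsub>M\<^esub> x) ` carrier M"
    and carrier_R: "carrier ?R = (\<lambda>v. reduced_cod S +>\<^bsub>V\<^esub> v) ` carrier V"
    by (simp_all add: dom_quotient_def cod_quotient_def M'.carrier_quotient_space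
        V'.carrier_quotient_space)
  have im: "T.imT = (\<lambda>x. reduced_cod S +>\<^bsub>V\<^esub> A x) ` carrier M"
    unfolding T.im_def carrier_Q image_image using bracket by (intro image_cong) simp_all
  have "beta_plus_1 K S = 0 \<longleftrightarrow> T.imT = carrier ?R"
    using im.dim_quotient_space_eq_0_iff[OF fin] by (simp add: beta_plus_1_def cokernel_space_def)
  also have "\<dots> \<longleftrightarrow> carrier ?R \<subseteq> T.imT"
    using im.subset by blast
  also have "\<dots> \<longleftrightarrow> (\<forall>v\<in>carrier V. \<exists>x\<in>carrier M. reduced_cod S +>\<^bsub>V\<^esub> v = reduced_cod S +>\<^bsub>V\<^esub> A x)"
    unfolding im carrier_R by blast
  also have "\<dots> \<longleftrightarrow> (\<forall>v\<in>carrier V. \<exists>x\<in>carrier M. v \<ominus>\<^bsub>V\<^esub> A x \<in> reduced_cod S)"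
    using V'.coset_eq_iff by auto
  finally show ?thesis .
qed

end

section \<open>Iterated reductions and surjectivity of \<open>E\<close>\<close>

lemma iter_reduce_0: "iter_reduce 0 S = S"
  by (simp add: iter_reduce_def)

text \<open>Splits off the innermost reduction, so that the defects of \<open>reduce S\<close> are
  those of \<open>S\<close> with the index shifted by one.\<close>

lemma iter_reduce_Suc: "iter_reduce (Suc k) S = iter_reduce k (reduce S)"
  by (simp add: iter_reduce_def funpow_swap1)

context linear_system
begin

lemma surj_E_lift:
  assumes "alpha_1 K S = 0" "beta_plus_1 K S = 0"
    and "reduced_cod (reduce S) = carrier (sys_cod (reduce S))"
  shows "reduced_cod S = carrier V"
proof -
  interpret V': subspace K "reduced_cod S" V by (rule subspace_reduced_cod)
  \<comment> \<open>Surjectivity of the reduced \<open>E\<close> means \<open>V'' = V'\<close>, that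
    is, \<open>E M' = E M\<close>.\<close>
  have "E ` reduced_dom S = E ` carrier M"
    using assms(3) by (simp add: reduced_cod_reduce) (simp add: reduce_def reduced_cod_def)
  then have M': "x \<in> reduced_dom S" if "x \<in> carrier M" for x
    using assms(1) that unfolding alpha_1_eq_0_iff by blast
  have "v \<in> reduced_cod S" if v: "v \<in> carrier V" for v
  proof -
    obtain x where x: "x \<in> carrier M" "v \<ominus>\<^bsub>V\<^esub> A x \<in> reduced_cod S"
      using assms(2) v unfolding beta_plus_1_eq_0_iff by blast
    \<comment> \<open>Here \<open>M' = M\<close> enters; \<open>v = (v - A x) + A x\<close> is then
      a sum of two elements of \<open>V'\<close>.\<close>
    have "A x \<in> reduced_cod S" using M'[OF x(1)] by (simp add: reduced_dom_def)
    from V'.add_mem[OF x(2) this] show ?thesis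
      using V'.minus_add_cancel v x(1) by simp
  qed
  then show ?thesis using V'.subset by blast
qed

text \<open>With \<open>V' = V\<close> also \<open>M' = M\<close>, and since \<open>reduce\<close>
  only replaces carriers, the records are literally equal.\<close>

lemma reduce_surj:
  assumes "reduced_cod S = carrier V"
  shows "reduce S = S"
proof -
  have "reduced_dom S = carrier M" using assms by (auto simp: reduced_dom_def)
  then show ?thesis using assms by (simp add: reduce_def)
qed

lemma iter_reduce_surj:
  assumes "reduced_cod S = carrier V"
  shows "iter_reduce k S = S"
  by (induction k) (simp_all add: iter_reduce_0 iter_reduce_Suc reduce_surj[OF assms])

lemma fully_reduced_surj:
  assumes "reduced_cod S = carrier V"
  shows "fully_reduced S = S"
  by (simp add: fully_reduced_def iter_reduce_surj[OF assms])

lemma beta_plus_surj: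
  assumes "reduced_cod S = carrier V"
  shows "beta_plus K k S = 0"
proof -
  have "\<exists>x\<in>carrier M. v \<ominus>\<^bsub>V\<^esub> A x \<in> reduced_cod S" if "v \<in> carrier V" for v
    \<comment> \<open>Since \<open>V' = V\<close>, any \<open>x\<close> would do; zero is an element
      that always exists.\<close>
    using that assms by (intro bexI[of _ "\<zero>\<^bsub>M\<^esub>"]) auto
  then show ?thesis
    unfolding beta_plus_def iter_reduce_surj[OF assms] beta_plus_1_eq_0_iff by blast
qed

lemma alpha_1_inj:
  assumes "inj_on E (carrier M)"
  shows "alpha_1 K S = 0"
  unfolding alpha_1_eq_0_iff using assms reduced_dom_subset by (auto dest: inj_onD)

end

text \<open>Reduction keeps the function \<open>E\<close> and shrinks its domain, so injectivity
  passes to all iterates.\<close>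

lemma alpha_inj:
  assumes "linear_system K S" "inj_on (sys_E S) (carrier (sys_dom S))"
  shows "alpha K k S = 0"
proof -
  have "linear_system K (iter_reduce j S)
    \<and> inj_on (sys_E (iter_reduce j S)) (carrier (sys_dom (iter_reduce j S)))" for j
    using assms
  proof (induction j arbitrary: S)
    case 0
    then show ?case by (simp add: iter_reduce_0)
  next
    case (Suc j)
    interpret linear_system K S by (rule Suc.prems)
    have "inj_on (sys_E (reduce S)) (carrier (sys_dom (reduce S)))"
      using Suc.prems(2) reduced_dom_subset by (auto simp: reduce_def intro: inj_on_subset)
    from Suc.IH[OF linear_system_reduce this] show ?case by (simp add: iter_reduce_Suc)
  qed
  then show ?thesis unfolding alpha_def using linear_system.alpha_1_inj by blast
qed

text \<open>If \<open>E\<close> were not surjective, the reduced system would have a codomain of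
  smaller dimension and, by induction, a surjective \<open>E\<close>; \<open>surj_E_lift\<close>
  carries this back to \<open>S\<close>.\<close>

lemma defects_zero_imp_surj:
  assumes "linear_system K S" "\<And>k. k \<ge> 1 \<Longrightarrow> alpha K k S = 0 \<and> beta_plus K k S = 0"
  shows "reduced_cod S = carrier (sys_cod S)"
  using assms
proof (induction "vectorspace.dim K (sys_cod S)" arbitrary: S rule: less_induct)
  case less
  interpret linear_system K S by (rule less.prems)
  show ?case
  proof (rule ccontr)
    assume proper: "reduced_cod S \<noteq> carrier (sys_cod S)"
    then have "vectorspace.dim K (sys_cod (reduce S)) < vectorspace.dim K (sys_cod S)"
      using E.W.dim_subspace_less[OF fin_dims(2) subspace_reduced_cod] by (simp add: reduce_def)
    \<comment> \<open>Defect \<open>k\<close> of \<open>reduce S\<close> is defect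
      \<open>Suc k\<close> of \<open>S\<close>; the case split on \<open>k\<close> resolves the
      truncated subtraction \<open>k - 1\<close>.\<close>
    moreover have "alpha K k (reduce S) = 0 \<and> beta_plus K k (reduce S) = 0" if "k \<ge> 1" for k
      using less.prems(2)[of "Suc k"] that
      by (cases k) (simp_all add: alpha_def beta_plus_def iter_reduce_Suc)
    ultimately have "reduced_cod (reduce S) = carrier (sys_cod (reduce S))"
      using less.hyps linear_system_reduce by blast
    moreover have "alpha_1 K S = 0" "beta_plus_1 K S = 0"
      using less.prems(2)[of 1] by (simp_all add: alpha_def beta_plus_def iter_reduce_0)
    ultimately show False using surj_E_lift proper by blast
  qed
qed

section \<open>The dual system and injectivity of \<open>E\<close>\<close>

context linear_system
begin

lemma linear_system_dual: "linear_system K (dual_system K S)"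
  using E.linear_map_adjoint A.linear_map_adjoint
    E.V.fin_dim_dual_space[OF fin_dims(1)] E.W.fin_dim_dual_space[OF fin_dims(2)]
  by (simp add: linear_system_def is_system_def dual_system_def)

text \<open>Functionals with the same composite with \<open>E\<close> agree on the image of
  \<open>E\<close>, which is all of \<open>V\<close>.\<close>

lemma inj_dual_E:
  assumes "reduced_cod S = carrier V"
  shows "inj_on (sys_E (dual_system K S)) (carrier (sys_dom (dual_system K S)))"
proof (rule inj_onI)
  fix f g
  assume "f \<in> carrier (sys_dom (dual_system K S))" "g \<in> carrier (sys_dom (dual_system K S))"
    and eq: "sys_E (dual_system K S) f = sys_E (dual_system K S) g"
  then have f: "f \<in> carrier V \<rightarrow>\<^sub>E carrier K" and g: "g \<in> carrier V \<rightarrow>\<^sub>E carrier K"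
    by (simp_all add: dual_system_def E.W.mem_dual_space_iff)
  have "f (E x) = g (E x)" if "x \<in> carrier M" for x
    using fun_cong[OF eq, of x] that by (simp add: dual_system_def adjoint_map_def compose_def)
  then have "f v = g v" if "v \<in> carrier V" for v
    using that assms unfolding reduced_cod_def by (metis imageE)
  then show "f = g" by (rule PiE_ext[OF f g])
qed

text \<open>Every functional on \<open>M\<close> factors through \<open>E\<close> and so cannot tell
  apart two vectors with the same image, whereas functionals separate points.\<close>

lemma dual_surj_imp_inj:
  assumes "reduced_cod (dual_system K S) = carrier (sys_cod (dual_system K S))"
  shows "inj_on E (carrier M)"
proof (rule inj_onI)
  fix x y assume x: "x \<in> carrier M" and y: "y \<in> carrier M" and "E x = E y"
  then have z: "x \<ominus>\<^bsub>M\<^esub> y \<in> carrier M" "E (x \<ominus>\<^bsub>M\<^esub> y) = E \<zero>\<^bsub>M\<^esub>" by simp_all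
  have "f (x \<ominus>\<^bsub>M\<^esub> y) = f \<zero>\<^bsub>M\<^esub>" if f: "f \<in> carrier (dual_space K M)" for f
  proof -
    have "f \<in> adjoint_map M E ` carrier (dual_space K V)"
      using f assms by (simp add: reduced_cod_def dual_system_def)
    then show ?thesis using z by (auto simp: adjoint_map_def compose_def)
  qed
  then have "x \<ominus>\<^bsub>M\<^esub> y = \<zero>\<^bsub>M\<^esub>"
    using E.V.dual_space_separates[OF fin_dims(1) z(1)] E.V.dual_space_apply_zero by simp
  then show "x = y" using x y by simp
qed

text \<open>A functional \<open>f\<close> on \<open>M\<close> is the adjoint image of
  \<open>f\<close> composed with the inverse of \<open>E\<close>.\<close>

lemma bij_imp_dual_surj:
  assumes bij: "bij_betw E (carrier M) (carrier V)"
  shows "reduced_cod (dual_system K S) = carrier (sys_cod (dual_system K S))"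
proof -
  let ?E' = "the_inv_into (carrier M) E"
  interpret E': linear_map K V M ?E' by (rule E.linear_map_the_inv_into[OF bij])
  interpret dual_E': linear_map K "dual_space K M" "dual_space K V" "adjoint_map V ?E'"
    by (rule E'.linear_map_adjoint)
  interpret dual_E: linear_map K "dual_space K V" "dual_space K M" "adjoint_map M E"
    by (rule E.linear_map_adjoint)
  have "f \<in> adjoint_map M E ` carrier (dual_space K V)" if f: "f \<in> carrier (dual_space K M)" for f
  proof
    show "adjoint_map V ?E' f \<in> carrier (dual_space K V)" using f by simp
    \<comment> \<open>Adjoint images are restricted to \<open>carrier M\<close>; outside it the two
      sides agree because \<open>f\<close> is extensional.\<close>
    have "f \<in> extensional (carrier M)" using f by (simp add: dual_space_def)
    then show "f = adjoint_map M E (adjoint_map V ?E' f)"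
      using the_inv_into_f_f[OF bij_betw_imp_inj_on[OF bij]]
      by (intro ext) (auto simp: adjoint_map_def compose_def extensional_def)
  qed
  then show ?thesis
    by (auto simp: reduced_cod_def dual_system_def)
qed

end

theorem proposition3p18:
  fixes K :: "('a, 'b) ring_scheme"
    and S :: "('a, 'm, 'v) system"
  assumes "field K"
    and "is_system K S"
  shows "(\<forall>k\<ge>1. alpha K k S = 0 \<and> beta_plus K k S = 0 \<and> beta_minus K k S = 0) \<longleftrightarrow>
    invertible_linear_map K (sys_dom S) (sys_cod S) (sys_E S)"
proof -
  interpret linear_system K S by (rule linear_system.intro) (rule assms)
  show ?thesis
  proof
    assume defects: "\<forall>k\<ge>1. alpha K k S = 0 \<and> beta_plus K k S = 0 \<and> beta_minus K k S = 0"
    then have surj: "reduced_cod S = carrier V"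
      using defects_zero_imp_surj[OF linear_system_axioms] by blast
    \<comment> \<open>\<open>S\<close> is its own full reduction, so its \<open>beta_minus\<close>
      is the \<open>beta_plus\<close> of \<open>dual_system K S\<close>.\<close>
    have "beta_plus K k (dual_system K S) = 0" if "k \<ge> 1" for k
      using defects that by (simp add: beta_minus_def fully_reduced_surj[OF surj])
    \<comment> \<open>The surjectivity criterion is applied a second time, to the dual; its
      \<open>alpha\<close> vanish because the adjoint of a surjective \<open>E\<close> is
      injective.\<close>
    then have "reduced_cod (dual_system K S) = carrier (sys_cod (dual_system K S))"
      using defects_zero_imp_surj[OF linear_system_dual]
        alpha_inj[OF linear_system_dual inj_dual_E[OF surj]] by blast
    then have "inj_on E (carrier M)" by (rule dual_surj_imp_inj)
    then show "invertible_linear_map K M V E"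
      using surj by (simp add: E.invertible_linear_map_iff bij_betw_def reduced_cod_def)
  next
    assume "invertible_linear_map K M V E"
    then have bij: "bij_betw E (carrier M) (carrier V)"
      by (simp add: E.invertible_linear_map_iff)
    then have surj: "reduced_cod S = carrier V" by (simp add: bij_betw_def reduced_cod_def)
    \<comment> \<open>Injectivity of \<open>E\<close> kills \<open>alpha\<close>, surjectivity kills
      \<open>beta_plus\<close>, and surjectivity of the adjoint kills
      \<open>beta_minus\<close>.\<close>
    show "\<forall>k\<ge>1. alpha K k S = 0 \<and> beta_plus K k S = 0 \<and> beta_minus K k S = 0"
      using alpha_inj[OF linear_system_axioms bij_betw_imp_inj_on[OF bij]] beta_plus_surj[OF surj]
        linear_system.beta_plus_surj[OF linear_system_dual bij_imp_dual_surj[OF bij]]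
      by (simp add: beta_minus_def fully_reduced_surj[OF surj])
  qed
qed

end
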